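(* For any codes $\mathcal{C}\subseteq 2^{[n]}$ and $\mathcal{D}\subseteq 2^{[n]}$, we have $$\operatorname{odim}(\mathcal{C}\sqcap \mathcal{D}) \le \operatorname{odim}(\mathcal{C}) + \operatorname{odim}(\mathcal{D}),$$ $$\operatorname{cdim}(\mathcal{C}\sqcap \mathcal{D}) \le \operatorname{cdim}(\mathcal{C}) + \operatorname{cdim}(\mathcal{D}),$$ $$\operatorname{bdim}(\mathcal{C}\sqcap \mathcal{D}) \le \operatorname{bdim}(\mathcal{C}) + \operatorname{bdim}(\mathcal{D}).$$
   Context: Write $[n]=\{1,\ldots,n\}$. A code is a set $\mathcal{C}\subseteq 2^{[n]}$. For an ordered (indexed) collection $\mathcal{U} = \{U_1, \ldots, U_n\}$ of sets in $\mathbb{R}^d$, its code is $$\operatorname{code}(\mathcal{U}) = \{\sigma\subseteq [n] \mid \text{there exists } p\in \mathbb{R}^d \text{ such that for all } i\in[n],\ p\in U_i \text{ if and only if } i\in\sigma\},$$ and $\mathcal{U}$ is called a realization of $\operatorname{code}(\mathcal{U})$. By standing convention, all sets in realizations are bounded. An axis-parallel box (box for short) in $\mathbb{R}^d$ is either the empty set or a product $[a_1,b_1]\times\cdots\times[a_d,b_d]$ of nonempty closed intervals (degenerate intervals $a_i=b_i$ allowed). $\operatorname{odim}(\mathcal{C})$ (respectively $\operatorname{cdim}(\mathcal{C})$, $\operatorname{bdim}(\mathcal{C})$) is the minimum $d$ such that $\mathcal{C}$ has a realization in $\mathbb{R}^d$ in which every set is open and convex (respectively closed and convex, a box). The minimum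 over the empty set is $\infty$. The intersection product of two codes $\mathcal{C},\mathcal{D}\subseteq 2^{[n]}$ is $\mathcal{C} \sqcap \mathcal{D} = \{ c_1 \cap c_2 \mid c_1\in \mathcal{C} \text{ and } c_2\in \mathcal{D}\}$. *)

theory Defs
  imports "HOL-Analysis.Analysis" "HOL-Library.Extended_Nat"
begin

text \<open>
  The dimension \<open>d\<close> ranges over the natural numbers inside the definitions below, so
  \<open>\<real>\<^sup>d\<close> is rendered as the library topology \<^term>\<open>Euclidean_space d\<close>: its points are the
  functions \<^typ>\<open>nat \<Rightarrow> real\<close> vanishing at every index \<open>i \<ge> d\<close>, and the coordinates are
  \<open>0, \<dots>, d - 1\<close>. The space \<open>\<real>\<^sup>0\<close> is a single point.
\<close>

abbreviation rspace :: "nat \<Rightarrow> (nat \<Rightarrow> real) set" where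
  "rspace d \<equiv> topspace (Euclidean_space d)"

text \<open>
  The type \<^typ>\<open>nat \<Rightarrow> real\<close> is not an instance of \<^class>\<open>real_vector\<close>, and its library metric is
  not the Euclidean one, so \<^const>\<open>convex\<close> and \<^const>\<open>bounded\<close> are restated with pointwise
  operations and the Euclidean norm.
\<close>

definition rconvex :: "(nat \<Rightarrow> real) set \<Rightarrow> bool" where
  "rconvex S \<longleftrightarrow>
    (\<forall>x\<in>S. \<forall>y\<in>S. \<forall>u\<ge>0. \<forall>v\<ge>0. u + v = 1 \<longrightarrow> (\<lambda>i. u * x i + v * y i) \<in> S)"

definition rbounded :: "nat \<Rightarrow> (nat \<Rightarrow> real) set \<Rightarrow> bool" where
  "rbounded d S \<longleftrightarrow> (\<exists>B. \<forall>x\<in>S. L2_set x {..<d} \<le> B)"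

definition open_convex :: "nat \<Rightarrow> (nat \<Rightarrow> real) set \<Rightarrow> bool" where
  "open_convex d S \<longleftrightarrow> openin (Euclidean_space d) S \<and> rconvex S"

definition closed_convex :: "nat \<Rightarrow> (nat \<Rightarrow> real) set \<Rightarrow> bool" where
  "closed_convex d S \<longleftrightarrow> closedin (Euclidean_space d) S \<and> rconvex S"

definition axis_box :: "nat \<Rightarrow> (nat \<Rightarrow> real) set \<Rightarrow> bool" where
  "axis_box d S \<longleftrightarrow> S = {} \<or>
    (\<exists>a b. (\<forall>i<d. a i \<le> b i) \<and> S = {x \<in> rspace d. \<forall>i<d. x i \<in> {a i..b i}})"

text \<open>Only the values of \<open>U\<close> at the indices \<open>1, \<dots>, n\<close> matter.\<close>

definition code_of :: "nat \<Rightarrow> nat \<Rightarrow> (nat \<Rightarrow> (nat \<Rightarrow> real) set) \<Rightarrow> nat set set" where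
  "code_of n d U =
    {\<sigma>. \<sigma> \<subseteq> {1..n} \<and> (\<exists>p\<in>rspace d. \<forall>i\<in>{1..n}. p \<in> U i \<longleftrightarrow> i \<in> \<sigma>)}"

definition realizable_in ::
  "(nat \<Rightarrow> (nat \<Rightarrow> real) set \<Rightarrow> bool) \<Rightarrow> nat \<Rightarrow> nat set set \<Rightarrow> nat \<Rightarrow> bool" where
  "realizable_in P n C d \<longleftrightarrow>
    (\<exists>U. (\<forall>i\<in>{1..n}. U i \<subseteq> rspace d \<and> rbounded d (U i) \<and> P d (U i)) \<and> code_of n d U = C)"

text \<open>In \<^typ>\<open>enat\<close>, an infimum of a nonempty set is attained and the infimum of \<open>{}\<close> is \<open>\<infinity>\<close>.\<close>

definition min_dim :: "(nat \<Rightarrow> (nat \<Rightarrow> real) set \<Rightarrow> bool) \<Rightarrow> nat \<Rightarrow> nat set set \<Rightarrow> enat" where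
  "min_dim P n C = (INF d\<in>{d. realizable_in P n C d}. enat d)"

definition odim :: "nat \<Rightarrow> nat set set \<Rightarrow> enat" where
  "odim = min_dim open_convex"

definition cdim :: "nat \<Rightarrow> nat set set \<Rightarrow> enat" where
  "cdim = min_dim closed_convex"

definition bdim :: "nat \<Rightarrow> nat set set \<Rightarrow> enat" where
  "bdim = min_dim axis_box"

definition inter_prod :: "nat set set \<Rightarrow> nat set set \<Rightarrow> nat set set"  (infixl "\<sqinter>\<^sub>c" 70) where
  "C \<sqinter>\<^sub>c D = {c1 \<inter> c2 | c1 c2. c1 \<in> C \<and> c2 \<in> D}"

end

theory Submission
  imports Defs
begin

text \<open>
  If \<open>U\<close> realizes \<open>C\<close> in \<open>\<real>\<^sup>d\<close> and \<open>V\<close> realizes \<open>D\<close> in \<open>\<real>\<^sup>e\<close>, then the products \<open>U i \<times> V i\<close> realize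
  \<open>C \<sqinter>\<^sub>c D\<close> in \<open>\<real>\<^sup>d\<^sup>+\<^sup>e\<close>: the point \<open>(p, q)\<close> lies in exactly those products for which \<open>p \<in> U i\<close>
  and \<open>q \<in> V i\<close>. Products preserve boundedness and each of the three shapes.
\<close>

text \<open>Points of \<open>rspace d\<close> vanish from index d on, hence the explicit cut-off
  here. The shift in \<open>proj_snd\<close> needs none: a point of \<open>rspace (d + e)\<close>
  already vanishes from d + e on.\<close>

definition proj_fst :: "nat \<Rightarrow> (nat \<Rightarrow> real) \<Rightarrow> nat \<Rightarrow> real" where
  "proj_fst d x = (\<lambda>i. if i < d then x i else 0)"

definition proj_snd :: "nat \<Rightarrow> (nat \<Rightarrow> real) \<Rightarrow> nat \<Rightarrow> real" where
  "proj_snd d x = (\<lambda>i. x (d + i))"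

text \<open>The product of S and T with \<open>\<real>\<^sup>d\<^sup>+\<^sup>e\<close> split into
  its first d and last e coordinates. Defining it through preimages reduces topology and convexity
  to continuity and linearity of the projections.\<close>

definition rprod ::
  "nat \<Rightarrow> nat \<Rightarrow> (nat \<Rightarrow> real) set \<Rightarrow> (nat \<Rightarrow> real) set \<Rightarrow> (nat \<Rightarrow> real) set" where
  "rprod d e S T = {x \<in> rspace (d + e). proj_fst d x \<in> S \<and> proj_snd d x \<in> T}"

lemma rspace_iff: "x \<in> rspace d \<longleftrightarrow> (\<forall>i\<ge>d. x i = 0)"
  by (simp add: topspace_Euclidean_space)

lemma proj_fst_rspace: "proj_fst d x \<in> rspace d"
  by (simp add: rspace_iff proj_fst_def)

lemma proj_snd_rspace: "x \<in> rspace (d + e) \<Longrightarrow> proj_snd d x \<in> rspace e"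
  by (simp add: rspace_iff proj_snd_def)

lemma ex_proj_eq:
  assumes "p \<in> rspace d" "q \<in> rspace e"
  obtains x where "x \<in> rspace (d + e)" "proj_fst d x = p" "proj_snd d x = q"
proof
  let ?x = "\<lambda>i. if i < d then p i else q (i - d)"
  show "?x \<in> rspace (d + e)" "proj_fst d ?x = p" "proj_snd d ?x = q"
    using assms by (auto simp: rspace_iff proj_fst_def proj_snd_def)
qed

text \<open>\<open>Euclidean_space d\<close> is a subspace of a product space, so continuity is
  coordinatewise; the coordinates from d on are constantly 0.\<close>

lemma continuous_map_into_Euclidean_space:
  assumes "\<And>i. i < d \<Longrightarrow> continuous_map X euclideanreal (\<lambda>x. f x i)"
    and "\<And>x. x \<in> topspace X \<Longrightarrow> f x \<in> rspace d"
  shows "continuous_map X (Euclidean_space d) f"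
proof -
  have "continuous_map X euclideanreal (\<lambda>x. f x i)" for i
  proof (cases "i < d")
    case False
    then have "0 = f x i" if "x \<in> topspace X" for x
      using assms(2)[OF that] by (simp add: rspace_iff)
    then show ?thesis
      by (rule continuous_map_eq[rotated]) simp_all
  qed (rule assms(1))
  with assms(2) show ?thesis
    by (auto simp: Euclidean_space_def continuous_map_in_subtopology
        continuous_map_componentwise_UNIV)
qed

lemma continuous_map_Euclidean_component:
  "continuous_map (Euclidean_space d) euclideanreal (\<lambda>x. x i)"
  unfolding Euclidean_space_def
  by (intro continuous_map_from_subtopology continuous_map_product_projection) simp

lemma continuous_map_proj_fst:
  "continuous_map (Euclidean_space (d + e)) (Euclidean_space d) (proj_fst d)"
  by (rule continuous_map_into_Euclidean_space)
    (simp_all add: proj_fst_rspace, simp add: proj_fst_def continuous_map_Euclidean_component)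

lemma continuous_map_proj_snd:
  "continuous_map (Euclidean_space (d + e)) (Euclidean_space e) (proj_snd d)"
  by (rule continuous_map_into_Euclidean_space)
    (simp_all add: proj_snd_rspace, simp add: proj_snd_def continuous_map_Euclidean_component)

lemma rprod_eq_Int:
  "rprod d e S T =
    {x \<in> rspace (d + e). proj_fst d x \<in> S} \<inter> {x \<in> rspace (d + e). proj_snd d x \<in> T}"
  by (auto simp: rprod_def)

lemma rconvex_rprod:
  assumes "rconvex S" "rconvex T"
  shows "rconvex (rprod d e S T)"
  unfolding rconvex_def
proof (intro ballI allI impI)
  fix x y and u v :: real
  assume xy: "x \<in> rprod d e S T" "y \<in> rprod d e S T" and uv: "u \<ge> 0" "v \<ge> 0" "u + v = 1"
  \<comment> \<open>Both projections are linear, so they send a convex combination to the same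
    combination of the images.\<close>
  have "proj_fst d (\<lambda>i. u * x i + v * y i) = (\<lambda>i. u * proj_fst d x i + v * proj_fst d y i)"
    "proj_snd d (\<lambda>i. u * x i + v * y i) = (\<lambda>i. u * proj_snd d x i + v * proj_snd d y i)"
    by (auto simp: proj_fst_def proj_snd_def)
  then show "(\<lambda>i. u * x i + v * y i) \<in> rprod d e S T"
    using assms xy uv by (simp add: rprod_def rconvex_def rspace_iff)
qed

lemma open_convex_rprod:
  assumes "open_convex d S" "open_convex e T"
  shows "open_convex (d + e) (rprod d e S T)"
  using assms unfolding open_convex_def
  by (auto intro!: rconvex_rprod, unfold rprod_eq_Int)
    (blast intro: openin_Int openin_continuous_map_preimage
      continuous_map_proj_fst continuous_map_proj_snd)

lemma closed_convex_rprod: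
  assumes "closed_convex d S" "closed_convex e T"
  shows "closed_convex (d + e) (rprod d e S T)"
  using assms unfolding closed_convex_def
  by (auto intro!: rconvex_rprod, unfold rprod_eq_Int)
    (blast intro: closedin_Int closedin_continuous_map_preimage
      continuous_map_proj_fst continuous_map_proj_snd)

lemma all_less_add_iff: "(\<forall>i<d + e. P i) \<longleftrightarrow> (\<forall>i<d. P i) \<and> (\<forall>i<e. P (d + i))" for d e :: nat
proof (intro iffI conjI; clarify)
  fix i assume "\<forall>i<d. P i" "\<forall>i<e. P (d + i)" "i < d + e"
  then show "P i"
    by (cases "i < d") (auto dest: spec[of _ "i - d"])
qed simp_all

lemma axis_box_rprod:
  assumes "axis_box d S" "axis_box e T"
  shows "axis_box (d + e) (rprod d e S T)"
proof (cases "S = {} \<or> T = {}")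
  case True
  \<comment> \<open>An empty factor makes the product empty, which counts as a box. It has no
    interval endpoints to concatenate, hence the case split.\<close>
  then show ?thesis by (auto simp: axis_box_def rprod_def)
next
  case False
  from False assms(1) obtain a b where
    S: "\<forall>i<d. a i \<le> b i" "S = {x \<in> rspace d. \<forall>i<d. x i \<in> {a i..b i}}"
    unfolding axis_box_def by (elim disjE exE conjE) simp_all
  from False assms(2) obtain a' b' where
    T: "\<forall>i<e. a' i \<le> b' i" "T = {x \<in> rspace e. \<forall>i<e. x i \<in> {a' i..b' i}}"
    unfolding axis_box_def by (elim disjE exE conjE) simp_all
  let ?A = "\<lambda>i. if i < d then a i else a' (i - d)"
  let ?B = "\<lambda>i. if i < d then b i else b' (i - d)"
  have "\<forall>i<d + e. ?A i \<le> ?B i"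
    using S(1) T(1) by (simp add: all_less_add_iff)
  moreover have "rprod d e S T = {x \<in> rspace (d + e). \<forall>i<d + e. x i \<in> {?A i..?B i}}"
    unfolding rprod_def S(2) T(2)
    \<comment> \<open>The projections stay folded at first so that their memberships in
      \<open>rspace\<close> are recognised; unfolding them then compares the two blocks of
      coordinates.\<close>
    by (auto simp: all_less_add_iff proj_fst_rspace proj_snd_rspace)
      (auto simp: proj_fst_def proj_snd_def)
  ultimately show ?thesis
    unfolding axis_box_def by (intro disjI2 exI[of _ ?A] exI[of _ ?B] conjI)
qed

lemma sum_lessThan_add:
  fixes f :: "nat \<Rightarrow> 'a::comm_monoid_add"
  shows "(\<Sum>i<d + e. f i) = (\<Sum>i<d. f i) + (\<Sum>i<e. f (d + i))"
  by (induction e) (simp_all add: add.assoc)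

text \<open>By Pythagoras the squared norm of (p, q) is the sum of the squared norms of p and q, and
  sqrt (a + b) \<le> sqrt a + sqrt b for nonnegative a, b. So bounds of the factors add up to a
  bound of the product.\<close>

lemma rbounded_rprod:
  assumes "rbounded d S" "rbounded e T"
  shows "rbounded (d + e) (rprod d e S T)"
proof -
  obtain A B where A: "\<forall>x\<in>S. L2_set x {..<d} \<le> A" and B: "\<forall>x\<in>T. L2_set x {..<e} \<le> B"
    using assms unfolding rbounded_def by blast
  have "L2_set x {..<d + e} \<le> A + B" if "x \<in> rprod d e S T" for x
  proof -
    have "L2_set x {..<d + e} =
        sqrt ((\<Sum>i<d. (proj_fst d x i)\<^sup>2) + (\<Sum>i<e. (proj_snd d x i)\<^sup>2))"
      by (simp add: L2_set_def sum_lessThan_add proj_fst_def proj_snd_def)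
    also have "\<dots> \<le> L2_set (proj_fst d x) {..<d} + L2_set (proj_snd d x) {..<e}"
      unfolding L2_set_def by (intro sqrt_add_le_add_sqrt sum_nonneg) auto
    also have "\<dots> \<le> A + B"
      using A B that by (intro add_mono) (auto simp: rprod_def)
    finally show ?thesis .
  qed
  then show ?thesis
    unfolding rbounded_def by blast
qed

lemma code_of_rprod:
  "code_of n (d + e) (\<lambda>i. rprod d e (U i) (V i)) = code_of n d U \<sqinter>\<^sub>c code_of n e V"
proof (intro equalityI subsetI)
  fix \<sigma> assume "\<sigma> \<in> code_of n (d + e) (\<lambda>i. rprod d e (U i) (V i))"
  then obtain x where \<sigma>: "\<sigma> \<subseteq> {1..n}" and x: "x \<in> rspace (d + e)"
    and mem: "\<forall>i\<in>{1..n}. x \<in> rprod d e (U i) (V i) \<longleftrightarrow> i \<in> \<sigma>"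
    unfolding code_of_def by blast
  \<comment> \<open>The codewords of the two projected points; code words are subsets of [n], hence
    the restriction of i.\<close>
  let ?c = "{i \<in> {1..n}. proj_fst d x \<in> U i}" and ?c' = "{i \<in> {1..n}. proj_snd d x \<in> V i}"
  have "?c \<in> code_of n d U"
    unfolding code_of_def using proj_fst_rspace[of d x] by blast
  moreover have "?c' \<in> code_of n e V"
    unfolding code_of_def using proj_snd_rspace[OF x] by blast
  moreover have "\<sigma> = ?c \<inter> ?c'"
    using \<sigma> mem x unfolding rprod_def by blast
  ultimately show "\<sigma> \<in> code_of n d U \<sqinter>\<^sub>c code_of n e V"
    unfolding inter_prod_def by blast
next
  fix \<sigma> assume "\<sigma> \<in> code_of n d U \<sqinter>\<^sub>c code_of n e V"
  then obtain c c' p q where \<sigma>: "\<sigma> = c \<inter> c'" "c \<subseteq> {1..n}"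
    and p: "p \<in> rspace d" "\<forall>i\<in>{1..n}. p \<in> U i \<longleftrightarrow> i \<in> c"
    and q: "q \<in> rspace e" "\<forall>i\<in>{1..n}. q \<in> V i \<longleftrightarrow> i \<in> c'"
    unfolding inter_prod_def code_of_def by blast
  \<comment> \<open>p and q come from independent realizations; concatenating their coordinates
    gives one point that carries both codewords.\<close>
  obtain x where x: "x \<in> rspace (d + e)" "proj_fst d x = p" "proj_snd d x = q"
    using ex_proj_eq p(1) q(1) by blast
  then have "\<forall>i\<in>{1..n}. x \<in> rprod d e (U i) (V i) \<longleftrightarrow> i \<in> \<sigma>"
    using p(2) q(2) \<sigma>(1) by (simp add: rprod_def)
  with x(1) \<sigma> show "\<sigma> \<in> code_of n (d + e) (\<lambda>i. rprod d e (U i) (V i))"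
    unfolding code_of_def by blast
qed

text \<open>The shape P is kept abstract so that open convex sets, closed convex sets and boxes
  share one argument.\<close>

lemma realizable_in_inter_prod:
  assumes P: "\<And>S T. P d S \<Longrightarrow> P e T \<Longrightarrow> P (d + e) (rprod d e S T)"
    and "realizable_in P n C d" "realizable_in P n D e"
  shows "realizable_in P n (C \<sqinter>\<^sub>c D) (d + e)"
proof -
  obtain U V where
    U: "\<forall>i\<in>{1..n}. U i \<subseteq> rspace d \<and> rbounded d (U i) \<and> P d (U i)" "code_of n d U = C" and
    V: "\<forall>i\<in>{1..n}. V i \<subseteq> rspace e \<and> rbounded e (V i) \<and> P e (V i)" "code_of n e V = D"
    using assms(2,3) unfolding realizable_in_def by blast
  have "rprod d e (U i) (V i) \<subseteq> rspace (d + e) \<and>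
      rbounded (d + e) (rprod d e (U i) (V i)) \<and> P (d + e) (rprod d e (U i) (V i))"
    if "i \<in> {1..n}" for i
    using bspec[OF U(1) that] bspec[OF V(1) that]
    by (intro conjI rbounded_rprod P) (auto simp: rprod_def)
  moreover have "code_of n (d + e) (\<lambda>i. rprod d e (U i) (V i)) = C \<sqinter>\<^sub>c D"
    by (simp add: code_of_rprod U(2) V(2))
  ultimately show ?thesis
    unfolding realizable_in_def by (intro exI[of _ "\<lambda>i. rprod d e (U i) (V i)"]) simp
qed

text \<open>A finite infimum cannot come from the empty set, whose infimum is \<infinity>, and a
  nonempty set in the well-order \<open>enat\<close> contains its infimum.\<close>

lemma min_dim_attained:
  assumes "min_dim P n C \<noteq> \<infinity>"
  obtains d where "realizable_in P n C d" "min_dim P n C = enat d"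
proof -
  have "{d. realizable_in P n C d} \<noteq> {}"
    using assms unfolding min_dim_def by (metis image_empty Inf_empty top_enat_def)
  then have "min_dim P n C \<in> enat ` {d. realizable_in P n C d}"
    unfolding min_dim_def by (metis all_not_in_conv imageI wellorder_InfI)
  then show thesis
    using that by blast
qed

lemma min_dim_inter_prod_le:
  assumes P: "\<And>d e S T. P d S \<Longrightarrow> P e T \<Longrightarrow> P (d + e) (rprod d e S T)"
  shows "min_dim P n (C \<sqinter>\<^sub>c D) \<le> min_dim P n C + min_dim P n D"
proof (cases "min_dim P n C = \<infinity> \<or> min_dim P n D = \<infinity>")
  \<comment> \<open>If either dimension is \<infinity>, so is the right-hand side. Otherwise optimal
    realizations of both codes exist and can be multiplied.\<close>
  case False
  then obtain d e where
    C: "realizable_in P n C d" "min_dim P n C = enat d" and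
    D: "realizable_in P n D e" "min_dim P n D = enat e"
    by (metis min_dim_attained)
  have "realizable_in P n (C \<sqinter>\<^sub>c D) (d + e)"
    using P C(1) D(1) by (rule realizable_in_inter_prod)
  then have "min_dim P n (C \<sqinter>\<^sub>c D) \<le> enat (d + e)"
    unfolding min_dim_def by (intro INF_lower) simp
  then show ?thesis
    by (simp add: C(2) D(2))
qed auto

theorem corollary4:
  fixes n :: nat and C D :: "nat set set"
  assumes "C \<subseteq> Pow {1..n}" and "D \<subseteq> Pow {1..n}"
  shows "odim n (C \<sqinter>\<^sub>c D) \<le> odim n C + odim n D
    \<and> cdim n (C \<sqinter>\<^sub>c D) \<le> cdim n C + cdim n D
    \<and> bdim n (C \<sqinter>\<^sub>c D) \<le> bdim n C + bdim n D"
  unfolding odim_def cdim_def bdim_def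
  using open_convex_rprod closed_convex_rprod axis_box_rprod
  by (simp add: min_dim_inter_prod_le)

end
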